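(* Let $G$ be a distribution function on $\mathbb{R}$. The following statements are equivalent: (i) There exist a distribution function $F$ and constants $a_n,b_n\in\mathbb{R}$, $a_n>0$ ($n\ge1$), such that $F^{\veebar n}(a_nx+b_n)\to G(x)$ as $n\to\infty$ at every continuity point $x$ of $G$. (ii) $G$ is of the type of a free extreme-value distribution, i.e. there exist real $a>0$ and $b$ such that $x\mapsto G(ax+b)$ is one of the following: (Type I, exponential) $x\mapsto(1-e^{-x})_+$; (Type II, Pareto) for some $\alpha>0$, $x\mapsto (1-x^{-\alpha})_+$ for $x>0$ and $0$ for $x\le0$; (Type III, Beta) for some $\alpha>0$, $x\mapsto 1-|x|^\alpha$ for $-1\le x\le 0$, $0$ for $x<-1$ and $1$ for $x>0$.
   Context: A distribution function on $\mathbb{R}$ is $F(t)=\mu((-\infty,t])$ for a Borel probability measure $\mu$ on $\mathbb{R}$. Write $u_+=\max(u,0)$. For distribution functions $F,G$ put $F\veebar G=(F+G-1)_+$ (upper extremal free convolution); its $n$-fold iterate is $F^{\veebar n}=(nF-(n-1))_+$, equivalently $1-F^{\veebar n}=\min(n(1-F),1)$.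
   Formalization: The formal theorem additionally assumes that G is not the distribution function of a point mass; for a point mass (i) holds with F = G, a_n = 1, b_n = 0 while (ii) fails, so the equivalence is false there. *)

theory Defs
  imports "HOL-Probability.Probability"
begin

definition distribution_function :: "(real \<Rightarrow> real) \<Rightarrow> bool" where
  "distribution_function F \<longleftrightarrow> (\<exists>M. real_distribution M \<and> F = cdf M)"

(* Point masses are the trivial limits of extreme-value theory. They are fixed by every iterate of
   free_max, so they are limits with a n = 1 and b n = 0, but they are not of any of the three types. *)
definition degenerate :: "(real \<Rightarrow> real) \<Rightarrow> bool" where
  "degenerate F \<longleftrightarrow> (\<exists>c. F = cdf (return borel c))"

definition free_max :: "(real \<Rightarrow> real) \<Rightarrow> (real \<Rightarrow> real) \<Rightarrow> real \<Rightarrow> real" where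
  "free_max F G = (\<lambda>t. max (F t + G t - 1) 0)"

(* The constant function 1 is the neutral element of free_max on distribution functions,
   so it is the natural value of the 0-fold iterate. *)
definition free_max_pow :: "nat \<Rightarrow> (real \<Rightarrow> real) \<Rightarrow> real \<Rightarrow> real" where
  "free_max_pow n F = (free_max F ^^ n) (\<lambda>_. 1)"

lemma distribution_function_bounds:
  assumes "distribution_function F"
  shows "0 \<le> F t" "F t \<le> 1"
proof -
  from assms obtain M where M: "real_distribution M" "F = cdf M"
    unfolding distribution_function_def by blast
  interpret real_distribution M by (fact M(1))
  show "0 \<le> F t" "F t \<le> 1"
    using M(2) cdf_nonneg cdf_bounded_prob by auto
qed

lemma free_max_pow_1:
  assumes "distribution_function F"
  shows "free_max_pow 1 F = F"
  using distribution_function_bounds(1)[OF assms]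
  by (auto simp: free_max_pow_def free_max_def fun_eq_iff max_def intro: order_antisym)

lemma free_max_pow_Suc: "free_max_pow (Suc n) F = free_max F (free_max_pow n F)"
  by (simp add: free_max_pow_def)

lemma free_max_pow_eq:
  assumes "distribution_function F"
  shows "free_max_pow n F t = max (real n * F t - (real n - 1)) 0"
proof (induction n)
  case 0
  then show ?case by (simp add: free_max_pow_def)
next
  case (Suc n)
  then show ?case
    using distribution_function_bounds(2)[OF assms, of t]
    by (auto simp: free_max_pow_Suc free_max_def max_def algebra_simps)
qed

definition free_exponential :: "real \<Rightarrow> real" where
  "free_exponential x = max (1 - exp (- x)) 0"

definition free_pareto :: "real \<Rightarrow> real \<Rightarrow> real" where
  "free_pareto \<alpha> x = (if 0 < x then max (1 - x powr (- \<alpha>)) 0 else 0)"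

definition free_beta :: "real \<Rightarrow> real \<Rightarrow> real" where
  "free_beta \<alpha> x = (if x < - 1 then 0 else if x \<le> 0 then 1 - \<bar>x\<bar> powr \<alpha> else 1)"

definition free_extreme_value :: "(real \<Rightarrow> real) \<Rightarrow> bool" where
  "free_extreme_value H \<longleftrightarrow>
     H = free_exponential \<or>
     (\<exists>\<alpha>>0. H = free_pareto \<alpha>) \<or>
     (\<exists>\<alpha>>0. H = free_beta \<alpha>)"

definition free_extreme_value_type :: "(real \<Rightarrow> real) \<Rightarrow> bool" where
  "free_extreme_value_type G \<longleftrightarrow>
     (\<exists>a b. a > 0 \<and> free_extreme_value (\<lambda>x. G (a * x + b)))"

end

theory Submission
  imports Defs "HOL-Real_Asymp.Real_Asymp"
begin

text \<open>
  The proof works with quantiles instead of distribution functions. Write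
  \<open>h v = inf {x. G x \<ge> 1 - exp (- v)}\<close> for \<open>v > 0\<close>. The iterate \<open>free_max_pow n F\<close> truncates
  \<open>1 - n (1 - F)\<close> at \<open>0\<close>, so its quantile at \<open>v > 0\<close> is the quantile of \<open>F\<close> at \<open>v + ln n\<close>: the iteration
  becomes a translation, and the truncation is invisible since only levels \<open>1 - exp (- v) > 0\<close>
  occur. Convergence of distribution functions gives convergence of quantiles, even along
  perturbed arguments (\<open>log_quantile_tendsto\<close>):
  if \<open>u n - ln (m n)\<close> tends to \<open>v\<close>, then the quantile of \<open>F\<close> at \<open>u n\<close>, normalised by \<open>a (m n)\<close> and
  \<open>b (m n)\<close>, tends to \<open>h v\<close>.

  Normalise the same quantile of \<open>F\<close>, at \<open>ln n + y + x\<close>, by the constants of index \<open>n\<close> and by those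
  of index \<open>m = \<lfloor>n exp y\<rfloor>\<close>. The first limit is \<open>h (x + y)\<close>, the second is \<open>h x\<close>. Differences in \<open>x\<close>
  do not see the centring, so \<open>a m / a n\<close> converges to some \<open>A y\<close>, and
  \<open>h (x + y) - h (z + y) = A y (h x - h z)\<close> (\<open>log_quantile_shift\<close>). The monotone nonconstant
  solutions are \<open>h\<close> affine, or \<open>h\<close> affine in \<open>exp (\<gamma> x)\<close> with \<open>\<gamma> \<noteq> 0\<close> (\<open>affine_shift_solutions\<close>);
  these are the quantiles of the exponential law and, for \<open>\<gamma> > 0\<close> and \<open>\<gamma> < 0\<close>, of the Pareto and
  Beta laws with exponent \<open>1 / \<bar>\<gamma>\<bar>\<close>.

  Passing to quantiles avoids the usual appeal to max-stability of \<open>G\<close> and convergence of types.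
  That appeal would be delicate here, because the iterate of a nondegenerate distribution function
  with a large jump at its right endpoint can be degenerate.

  Conversely, each of the three laws is stable: its \<open>n\<close>-th iterate is an affine rescaling of the
  law itself (\<open>free_extreme_value_stable\<close>), so \<open>F = G\<close> works, with equality for every \<open>n \<ge> 1\<close>.
\<close>

section \<open>Quantiles on the logarithmic scale\<close>

text \<open>
  The logarithmic scale \<open>v = - ln (1 - p)\<close> of the level \<open>p\<close> turns the \<open>n\<close>-fold iterate into the
  translation of \<open>v\<close> by \<open>ln n\<close>.
\<close>

definition log_quantile :: "(real \<Rightarrow> real) \<Rightarrow> real \<Rightarrow> real" where
  "log_quantile F v = Inf {x. 1 - exp (- v) \<le> F x}"

lemma distribution_function_mono:
  assumes "distribution_function F"
  shows "mono F"
proof -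
  from assms obtain M where M: "real_distribution M" "F = cdf M"
    unfolding distribution_function_def by blast
  interpret real_distribution M by (fact M(1))
  show ?thesis
    using M(2) cdf_nondecreasing by (auto intro: monoI)
qed

lemma log_quantile_le_iff:
  assumes "distribution_function F" and "v > 0"
  shows "log_quantile F v \<le> x \<longleftrightarrow> 1 - exp (- v) \<le> F x"
proof -
  from assms(1) obtain M where M: "real_distribution M" "F = cdf M"
    unfolding distribution_function_def by blast
  interpret cdf_distribution M by (rule cdf_distribution.intro) (fact M(1))
  show ?thesis
    using pseudoinverse[of "1 - exp (- v)" x] assms(2)
    unfolding log_quantile_def M(2) by auto
qed

lemma log_quantile_mono:
  assumes "distribution_function F" and "0 < v" "v \<le> w"
  shows "log_quantile F v \<le> log_quantile F w"
proof -
  have "1 - exp (- w) \<le> F (log_quantile F w)"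
    using log_quantile_le_iff[OF assms(1), of w "log_quantile F w"] assms(2,3) by simp
  then have "1 - exp (- v) \<le> F (log_quantile F w)"
    using assms(3) by (smt (verit) exp_le_cancel_iff)
  then show ?thesis
    using log_quantile_le_iff[OF assms(1,2)] by simp
qed

text \<open>
  A quantile function is a left-continuous inverse: \<open>F c < 1 - exp (- v)\<close> is an open condition on
  \<open>v\<close>. This later carries identities from a dense set of arguments to all of them.
\<close>

lemma log_quantile_left_continuous:
  assumes F: "distribution_function F" and "0 < v"
  shows "(log_quantile F \<longlongrightarrow> log_quantile F v) (at_left v)"
proof (rule order_tendstoI)
  have pos: "eventually (\<lambda>w. w \<in> {0<..<v}) (at_left v)"
    by (rule eventually_at_leftI[of 0]) (use assms(2) in auto)
  fix c assume "c < log_quantile F v"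
  then have "F c < 1 - exp (- v)"
    using log_quantile_le_iff[OF assms, of c] by simp
  moreover have "((\<lambda>w. 1 - exp (- w)) \<longlongrightarrow> 1 - exp (- v)) (at_left v)"
    by (intro tendsto_intros)
  ultimately have "eventually (\<lambda>w. F c < 1 - exp (- w)) (at_left v)"
    by (rule order_tendstoD(1)[rotated])
  with pos show "eventually (\<lambda>w. c < log_quantile F w) (at_left v)"
  proof eventually_elim
    case (elim w)
    then show ?case using log_quantile_le_iff[OF F, of w c] by simp
  qed
next
  have pos: "eventually (\<lambda>w. w \<in> {0<..<v}) (at_left v)"
    by (rule eventually_at_leftI[of 0]) (use assms(2) in auto)
  fix c assume "log_quantile F v < c"
  from pos show "eventually (\<lambda>w. log_quantile F w < c) (at_left v)"
  proof (eventually_elim)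
    case (elim w)
    then show ?case using log_quantile_mono[OF F, of w v] \<open>log_quantile F v < c\<close> by auto
  qed
qed

lemma countable_log_quantile_discont:
  assumes "distribution_function F"
  shows "countable {v. 0 < v \<and> \<not> isCont (log_quantile F) v}"
proof -
  have "mono_on {0<..} (log_quantile F)"
    using log_quantile_mono[OF assms] by (auto intro: mono_onI)
  from mono_on_ctble_discont_open[OF open_greaterThan this] show ?thesis
    by simp
qed

lemma exists_outside_countable:
  fixes p q :: real
  assumes "countable B" "p < q"
  shows "\<exists>x. p < x \<and> x < q \<and> x \<notin> B"
proof -
  have "uncountable ({p<..<q} - B)"
    using assms by (simp add: uncountable_open_interval uncountable_minus_countable)
  then obtain x where "x \<in> {p<..<q} - B"
    by (metis countable_empty equals0I)
  then show ?thesis by auto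
qed

text \<open>
  The arguments \<open>v > 0\<close> reach every level in the open unit interval, so a single quantile means a
  single atom. The value at the atom is the limit \<open>v \<rightarrow> \<infinity>\<close>, the value to its left the limit \<open>v \<rightarrow> 0\<close>.
\<close>

lemma constant_log_quantile_imp_degenerate:
  assumes F: "distribution_function F" and const: "\<And>v. v > 0 \<Longrightarrow> log_quantile F v = c"
  shows "degenerate F"
proof -
  have le: "c \<le> x \<longleftrightarrow> 1 - exp (- v) \<le> F x" if "v > 0" for x v
    using log_quantile_le_iff[OF F that] const[OF that] by simp
  have "F x = cdf (return borel c) x" for x
  proof (cases "c \<le> x")
    case True
    have "((\<lambda>v. 1 - exp (- v)) \<longlongrightarrow> (1::real)) at_top"
      by real_asymp
    then have "1 \<le> F x"
    proof (rule tendsto_upperbound)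
      show "eventually (\<lambda>v. 1 - exp (- v) \<le> F x) at_top"
        using eventually_gt_at_top[of 0] by eventually_elim (use le True in blast)
    qed simp
    then show ?thesis
      using distribution_function_bounds(2)[OF F, of x] True
      by (simp add: cdf_def measure_return)
  next
    case False
    have "((\<lambda>v. 1 - exp (- v)) \<longlongrightarrow> 1 - exp (- 0)) (at_right (0::real))"
      by (intro tendsto_intros)
    then have "F x \<le> 1 - exp (- 0)"
    proof (rule tendsto_lowerbound)
      show "eventually (\<lambda>v. F x \<le> 1 - exp (- v)) (at_right 0)"
        using eventually_at_right_less[of "0::real"]
        by eventually_elim (use le[of _ x] False in force)
    qed simp
    then show ?thesis
      using distribution_function_bounds(1)[OF F, of x] False
      by (simp add: cdf_def measure_return)
  qed
  then show ?thesis
    unfolding degenerate_def by blast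
qed

lemma exists_log_quantile_less:
  assumes F: "distribution_function F" and "\<not> degenerate F"
  shows "\<exists>p q. 0 < p \<and> 0 < q \<and> log_quantile F p < log_quantile F q"
proof (rule ccontr)
  assume "\<not> ?thesis"
  then have "log_quantile F v = log_quantile F 1" if "v > 0" for v
    using that by (meson linorder_neqE_linordered_idom zero_less_one)
  from constant_log_quantile_imp_degenerate[OF F this] assms(2) show False by blast
qed

section \<open>From convergence of distribution functions to convergence of quantiles\<close>

lemma free_max_pow_level_iff:
  assumes "distribution_function F" "m \<ge> 1" "w > 0"
  shows "1 - exp (- w) < free_max_pow m F t \<longleftrightarrow> 1 - exp (- (w + ln m)) < F t"
    and "free_max_pow m F t < 1 - exp (- w) \<longleftrightarrow> F t < 1 - exp (- (w + ln m))"
proof -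
  have e: "exp (- (w + ln m)) = exp (- w) / m"
    using assms(2) by (simp add: exp_diff exp_minus field_simps exp_add)
  have c: "0 < exp (- w)" "exp (- w) < 1"
    using assms(3) by simp_all
  have gt: "1 - c < max (real m * s - (real m - 1)) 0 \<longleftrightarrow> 1 - c / m < s"
    and lt: "max (real m * s - (real m - 1)) 0 < 1 - c \<longleftrightarrow> s < 1 - c / m"
    if "0 < c" "c < 1" for c s :: real
    using that assms(2) by (auto simp: field_simps max_def)
  show "1 - exp (- w) < free_max_pow m F t \<longleftrightarrow> 1 - exp (- (w + ln m)) < F t"
    unfolding e free_max_pow_eq[OF assms(1)] using gt[OF c] .
  show "free_max_pow m F t < 1 - exp (- w) \<longleftrightarrow> F t < 1 - exp (- (w + ln m))"
    unfolding e free_max_pow_eq[OF assms(1)] using lt[OF c] .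
qed

text \<open>
  Continuity of the quantile of \<open>G\<close> at \<open>v\<close> leaves room for both errors. If \<open>c\<close> exceeds the quantile
  at \<open>v\<close>, it exceeds the one at some \<open>w > v\<close>; at a continuity point \<open>x\<close> of \<open>G\<close> in between, the iterates
  are eventually above the level \<open>1 - exp (- w')\<close> for some \<open>w'\<close> with \<open>v < w' < w\<close>, while \<open>u n - ln (m n)\<close> is eventually below
  \<open>w'\<close>. The lower bound is symmetric; there \<open>w < v\<close> itself serves as \<open>w'\<close>.
\<close>

lemma log_quantile_tendsto:
  fixes a b :: "nat \<Rightarrow> real" and m :: "nat \<Rightarrow> nat" and u :: "nat \<Rightarrow> real"
  assumes F: "distribution_function F" and G: "distribution_function G"
    and a: "\<And>n. n \<ge> 1 \<Longrightarrow> a n > 0"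
    and lim: "\<And>x. isCont G x \<Longrightarrow> (\<lambda>n. free_max_pow n F (a n * x + b n)) \<longlonglongrightarrow> G x"
    and m: "filterlim m at_top sequentially"
    and u: "(\<lambda>n. u n - ln (real (m n))) \<longlonglongrightarrow> v"
    and v: "v > 0" "isCont (log_quantile G) v"
  shows "(\<lambda>n. (log_quantile F (u n) - b (m n)) / a (m n)) \<longlonglongrightarrow> log_quantile G v"
proof (rule order_tendstoI)
  have cd: "countable {x. \<not> isCont G x}"
    by (rule mono_ctble_discont) (rule distribution_function_mono[OF G])
  have m1: "eventually (\<lambda>n. m n \<ge> 1) sequentially"
    using m by (simp add: filterlim_at_top)
  have limm: "(\<lambda>n. free_max_pow (m n) F (a (m n) * x + b (m n))) \<longlonglongrightarrow> G x" if "isCont G x" for x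
    using filterlim_compose[OF lim[OF that] m] .
  {
    fix c assume c: "log_quantile G v < c"
    have "eventually (\<lambda>w. log_quantile G w < c) (at_right v)"
      using order_tendstoD(2)[OF v(2)[unfolded isCont_def] c] by (simp add: eventually_at_split)
    then obtain d where d: "d > v" "\<And>w. v < w \<Longrightarrow> w < d \<Longrightarrow> log_quantile G w < c"
      unfolding eventually_at_right_field by blast
    from dense[OF d(1)] obtain w where w: "w > v" "log_quantile G w < c"
      using d(2) by blast
    obtain x where x: "log_quantile G w < x" "x < c" "isCont G x"
      using exists_outside_countable[OF cd w(2)] by auto
    obtain w' where w': "v < w'" "w' < w"
      using dense[OF w(1)] by blast
    have "1 - exp (- w) \<le> G x"
      using log_quantile_le_iff[OF G, of w x] x(1) w(1) v(1) by simp
    moreover have "1 - exp (- w') < 1 - exp (- w)"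
      using w' by simp
    ultimately have "1 - exp (- w') < G x"
      by linarith
    from order_tendstoD(1)[OF limm[OF x(3)] this] order_tendstoD(2)[OF u w'(1)]
      order_tendstoD(1)[OF u v(1)] m1
    show "eventually (\<lambda>n. (log_quantile F (u n) - b (m n)) / a (m n) < c) sequentially"
    proof eventually_elim
      case (elim n)
      have un: "u n > 0"
        using elim(3,4) ln_ge_zero[of "real (m n)"] by linarith
      have "1 - exp (- (w' + ln (m n))) < F (a (m n) * x + b (m n))"
        using elim(1,4) free_max_pow_level_iff(1)[OF F, of "m n" w'] w' v(1) by simp
      moreover have "exp (- (w' + ln (m n))) \<le> exp (- u n)"
        using elim(2) by simp
      ultimately have "1 - exp (- u n) \<le> F (a (m n) * x + b (m n))"
        by linarith
      then have "log_quantile F (u n) \<le> a (m n) * x + b (m n)"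
        using log_quantile_le_iff[OF F un] by blast
      then have "(log_quantile F (u n) - b (m n)) / a (m n) \<le> x"
        using a[OF elim(4)] by (simp add: field_simps)
      then show ?case using x(2) by linarith
    qed
  }
  {
    fix c assume c: "c < log_quantile G v"
    have "eventually (\<lambda>w. c < log_quantile G w) (at_left v)"
      using order_tendstoD(1)[OF v(2)[unfolded isCont_def] c] by (simp add: eventually_at_split)
    then obtain d where d: "d < v" "\<And>w. d < w \<Longrightarrow> w < v \<Longrightarrow> c < log_quantile G w"
      unfolding eventually_at_left_field by blast
    have "max d 0 < v"
      using d(1) v(1) by simp
    from dense[OF this] obtain w where w: "0 < w" "w < v" "c < log_quantile G w"
      using d(2) by auto
    obtain x where x: "c < x" "x < log_quantile G w" "isCont G x"
      using exists_outside_countable[OF cd w(3)] by auto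
    have "G x < 1 - exp (- w)"
      using log_quantile_le_iff[OF G w(1), of x] x(2) by simp
    from order_tendstoD(2)[OF limm[OF x(3)] this] order_tendstoD(1)[OF u w(2)] m1
    show "eventually (\<lambda>n. c < (log_quantile F (u n) - b (m n)) / a (m n)) sequentially"
    proof eventually_elim
      case (elim n)
      have un: "u n > 0"
        using elim(2,3) ln_ge_zero[of "real (m n)"] w(1) by linarith
      have "F (a (m n) * x + b (m n)) < 1 - exp (- (w + ln (m n)))"
        using elim(1,3) free_max_pow_level_iff(2)[OF F, of "m n" w] w by simp
      moreover have "exp (- u n) \<le> exp (- (w + ln (m n)))"
        using elim(2) by simp
      ultimately have "\<not> 1 - exp (- u n) \<le> F (a (m n) * x + b (m n))"
        by linarith
      then have "a (m n) * x + b (m n) < log_quantile F (u n)"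
        using log_quantile_le_iff[OF F un] by (meson not_le)
      then have "x < (log_quantile F (u n) - b (m n)) / a (m n)"
        using a[OF elim(3)] by (simp add: field_simps)
      then show ?case using x(1) by linarith
    qed
  }
qed

section \<open>The functional equation of the limiting quantile\<close>

lemma ln_floor_shift: "(\<lambda>n. ln (real n) + y + x - ln (real (nat \<lfloor>real n * exp y\<rfloor>))) \<longlonglongrightarrow> x"
  by real_asymp

text \<open>
  The values \<open>A = lim a (m n) / a n\<close> and the equation come from comparing two normalisations of
  the same quantiles of \<open>F\<close>. The comparison needs \<open>x\<close> and \<open>x + y\<close> to be continuity points of the
  quantile of \<open>G\<close>, which excludes a countable set \<open>B\<close>; left-continuity then fills the gaps.
\<close>

lemma log_quantile_shift:
  fixes a b :: "nat \<Rightarrow> real"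
  assumes F: "distribution_function F" and G: "distribution_function G" "\<not> degenerate G"
    and a: "\<And>n. n \<ge> 1 \<Longrightarrow> a n > 0"
    and lim: "\<And>x. isCont G x \<Longrightarrow> (\<lambda>n. free_max_pow n F (a n * x + b n)) \<longlonglongrightarrow> G x"
    and y: "y \<ge> 0"
  shows "\<exists>A. \<forall>x>0. \<forall>z>0. log_quantile G (x + y) - log_quantile G (z + y)
           = A * (log_quantile G x - log_quantile G z)"
proof -
  define h where "h = log_quantile G"
  define q where "q = (\<lambda>n x. log_quantile F (ln (real n) + y + x))"
  define m where "m = (\<lambda>n. nat \<lfloor>real n * exp y\<rfloor>)"
  define B where "B = {x. 0 < x \<and> \<not> isCont h x} \<union> (\<lambda>x. x - y) ` {x. 0 < x \<and> \<not> isCont h x}"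
  define r where "r = (\<lambda>n. a (m n) / a n)"
  have B: "countable B"
    unfolding B_def h_def using countable_log_quantile_discont[OF G(1)] by auto
  have good: "isCont h x \<and> isCont h (x + y)" if "x > 0" "x \<notin> B" for x
  proof -
    have "isCont h (x + y)"
    proof (rule ccontr)
      assume "\<not> ?thesis"
      with that(1) y have "x + y \<in> {x. 0 < x \<and> \<not> isCont h x}" by simp
      then have "(x + y) - y \<in> B" unfolding B_def by blast
      with that(2) show False by simp
    qed
    with that show ?thesis unfolding B_def by auto
  qed
  have mono: "h x \<le> h z" if "0 < x" "x \<le> z" for x z
    unfolding h_def using log_quantile_mono[OF G(1) that] .
  have left: "(h \<longlongrightarrow> h x) (at_left x)" if "0 < x" for x
    unfolding h_def using log_quantile_left_continuous[OF G(1) that] .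
  have mtop: "filterlim m at_top sequentially"
    unfolding m_def by real_asymp
  have m1: "eventually (\<lambda>n. m n \<ge> 1 \<and> n \<ge> 1) sequentially"
    using mtop eventually_ge_at_top[of 1] by (simp add: filterlim_at_top eventually_conj)
  have P: "(\<lambda>n. (q n x - q n z) / a n) \<longlonglongrightarrow> h (x + y) - h (z + y)"
    if "x > 0" "x \<notin> B" "z > 0" "z \<notin> B" for x z
  proof -
    have *: "(\<lambda>n. (q n x - b n) / a n) \<longlonglongrightarrow> h (x + y)" if "x > 0" "x \<notin> B" for x
      unfolding q_def h_def
      by (rule log_quantile_tendsto[OF F G(1) a lim, where m = "\<lambda>n. n"])
         (use that y good[OF that] in \<open>auto simp: filterlim_ident add_ac h_def\<close>)
    show ?thesis
      using tendsto_diff[OF *[of x] *[of z]] that by (simp flip: diff_divide_distrib)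
  qed
  have um: "(\<lambda>n. ln (real n) + y + x - ln (real (m n))) \<longlonglongrightarrow> x" for x
    unfolding m_def by (rule ln_floor_shift)
  have Q: "(\<lambda>n. (q n x - q n z) / a (m n)) \<longlonglongrightarrow> h x - h z"
    if "x > 0" "x \<notin> B" "z > 0" "z \<notin> B" for x z
  proof -
    have *: "(\<lambda>n. (q n x - b (m n)) / a (m n)) \<longlonglongrightarrow> h x" if "x > 0" "x \<notin> B" for x
      unfolding q_def h_def
      by (rule log_quantile_tendsto[OF F G(1) a lim mtop])
         (use that good[OF that] in \<open>auto simp: h_def intro: um\<close>)
    show ?thesis
      using tendsto_diff[OF *[of x] *[of z]] that by (simp flip: diff_divide_distrib)
  qed
  have PQ: "eventually (\<lambda>n. (q n x - q n z) / a n = r n * ((q n x - q n z) / a (m n))) sequentially"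
    for x z
    using m1
  proof eventually_elim
    case (elim n)
    then show ?case
      using a[of n] a[of "m n"] by (simp add: r_def)
  qed
  \<comment> \<open>A pair of admissible points with distinct quantiles: it makes the limit of the ratio exist.\<close>
  obtain x1 x2 where x12: "0 < x1" "x1 \<notin> B" "0 < x2" "x2 \<notin> B" "h x1 < h x2"
  proof -
    obtain p p' where p: "0 < p" "0 < p'" "h p < h p'"
      using exists_log_quantile_less[OF G] unfolding h_def by blast
    obtain x1 where x1: "0 < x1" "x1 < p" "x1 \<notin> B"
      using exists_outside_countable[OF B p(1)] by blast
    have "eventually (\<lambda>w. h p < h w) (at_left p')"
      using order_tendstoD(1)[OF left[OF p(2)] p(3)] .
    then obtain l where l: "l < p'" "\<And>w. l < w \<Longrightarrow> w < p' \<Longrightarrow> h p < h w"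
      unfolding eventually_at_left_field by blast
    obtain x2 where x2: "max l 0 < x2" "x2 < p'" "x2 \<notin> B"
      using exists_outside_countable[OF B, of "max l 0" p'] l(1) p(2) by auto
    have "h x1 < h x2"
      using mono[of x1 p] x1 l(2)[of x2] x2 by auto
    with that x1 x2 show ?thesis by auto
  qed
  define A where "A = (h (x2 + y) - h (x1 + y)) / (h x2 - h x1)"
  have r: "r \<longlonglongrightarrow> A"
  proof -
    let ?P = "\<lambda>n. (q n x2 - q n x1) / a n" and ?Q = "\<lambda>n. (q n x2 - q n x1) / a (m n)"
    have Q12: "?Q \<longlonglongrightarrow> h x2 - h x1" by (rule Q) (use x12 in auto)
    have "(\<lambda>n. ?P n / ?Q n) \<longlonglongrightarrow> A"
      unfolding A_def
      by (intro tendsto_divide P Q12) (use x12 in auto)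
    moreover have "eventually (\<lambda>n. ?P n / ?Q n = r n) sequentially"
    proof -
      have "eventually (\<lambda>n. 0 < ?Q n) sequentially"
        by (rule order_tendstoD(1)[OF Q12]) (use x12(5) in simp)
      with PQ[of x2 x1] show ?thesis
        by eventually_elim (metis less_irrefl nonzero_mult_div_cancel_right)
    qed
    ultimately show ?thesis
      by (rule Lim_transform_eventually)
  qed
  have eq: "h (x + y) - h (z + y) = A * (h x - h z)"
    if "x > 0" "x \<notin> B" "z > 0" "z \<notin> B" for x z
  proof -
    have "(\<lambda>n. r n * ((q n x - q n z) / a (m n))) \<longlonglongrightarrow> A * (h x - h z)"
      by (intro tendsto_mult r Q that)
    moreover have "(\<lambda>n. r n * ((q n x - q n z) / a (m n))) \<longlonglongrightarrow> h (x + y) - h (z + y)"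
      using P[OF that] PQ by (rule Lim_transform_eventually)
    ultimately show ?thesis
      by (rule LIMSEQ_unique[symmetric])
  qed
  \<comment> \<open>\<open>h (w + y) - A * h w\<close> is left-continuous in \<open>w\<close> and constant off the countable set \<open>B\<close>.\<close>
  have eq': "h (x + y) - A * h x = h (x1 + y) - A * h x1" if "x > 0" for x
  proof (rule ccontr)
    assume ne: "\<not> ?thesis"
    have "filterlim (\<lambda>w. w + y) (at_left (x + y)) (at_left x)"
      by (auto simp: filterlim_at eventually_at_filter intro!: tendsto_eq_intros)
    then have "((\<lambda>w. h (w + y)) \<longlongrightarrow> h (x + y)) (at_left x)"
      using left[of "x + y"] that y by (auto intro: filterlim_compose)
    then have "((\<lambda>w. h (w + y) - A * h w) \<longlongrightarrow> h (x + y) - A * h x) (at_left x)"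
      by (intro tendsto_intros left that)
    then have "eventually (\<lambda>w. h (w + y) - A * h w \<noteq> h (x1 + y) - A * h x1) (at_left x)"
      using ne by (rule tendsto_imp_eventually_ne)
    then obtain l where l: "l < x"
      "\<And>w. l < w \<Longrightarrow> w < x \<Longrightarrow> h (w + y) - A * h w \<noteq> h (x1 + y) - A * h x1"
      unfolding eventually_at_left_field by blast
    from exists_outside_countable[OF B, of "max l 0" x] l(1) that
    obtain w where "max l 0 < w" "w < x" "w \<notin> B"
      by auto
    with l(2)[of w] eq[of w x1] x12(1,2) show False
      by (simp add: algebra_simps)
  qed
  have "h (x + y) - h (z + y) = A * (h x - h z)" if "x > 0" "z > 0" for x z
    using eq'[OF that(1)] eq'[OF that(2)] by (simp add: algebra_simps)
  then show ?thesis
    unfolding h_def by blast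
qed

text \<open>
  Cauchy's equation on the half-line. Nonnegativity makes \<open>f\<close> monotone, which squeezes \<open>n f(x)\<close>
  between the values of \<open>f\<close> at two consecutive integers around \<open>n x\<close>.
\<close>

lemma nonneg_additive_imp_linear:
  fixes f :: "real \<Rightarrow> real"
  assumes nonneg: "\<And>x. x \<ge> 0 \<Longrightarrow> f x \<ge> 0"
    and add: "\<And>x y. x \<ge> 0 \<Longrightarrow> y \<ge> 0 \<Longrightarrow> f (x + y) = f x + f y"
    and "x \<ge> 0"
  shows "f x = x * f 1"
proof -
  have mono: "f y \<le> f z" if "0 \<le> y" "y \<le> z" for y z
    using add[of y "z - y"] nonneg[of "z - y"] that by simp
  have mult: "f (real n * y) = real n * f y" if "y \<ge> 0" for n y
  proof (induction n)
    case 0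
    then show ?case using add[of 0 0] by simp
  next
    case (Suc n)
    then show ?case using add[of "real n * y" y] that by (simp add: algebra_simps)
  qed
  have f1: "f (real n) = real n * f 1" for n
    using mult[of 1 n] by simp
  have bound: "\<bar>f x - x * f 1\<bar> \<le> f 1 / real n" if "n > 0" for n :: nat
  proof -
    define k where "k = nat \<lfloor>real n * x\<rfloor>"
    have k: "real k \<le> real n * x" "real n * x \<le> real (Suc k)"
      using \<open>x \<ge> 0\<close> real_of_int_floor_add_one_ge[of "real n * x"]
      unfolding k_def by (auto simp: add.commute)
    have "real k * f 1 \<le> real n * f x" "real n * f x \<le> real (Suc k) * f 1"
      using mono[OF _ k(1)] mono[OF _ k(2)] \<open>x \<ge> 0\<close> by (auto simp only: mult f1) auto
    moreover have "real k * f 1 \<le> real n * x * f 1" "real n * x * f 1 \<le> real (Suc k) * f 1"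
      using k nonneg[of 1] by (auto intro: mult_right_mono)
    ultimately have "\<bar>real n * f x - real n * x * f 1\<bar> \<le> f 1"
      by (simp add: algebra_simps)
    moreover have "real n * f x - real n * x * f 1 = real n * (f x - x * f 1)"
      by (simp add: algebra_simps)
    ultimately have "real n * \<bar>f x - x * f 1\<bar> \<le> f 1"
      by (simp only: abs_mult abs_of_nat)
    then show ?thesis
      using that by (simp add: pos_le_divide_eq mult.commute)
  qed
  have "(\<lambda>n. f 1 / real n) \<longlonglongrightarrow> 0"
    by real_asymp
  then have "\<bar>f x - x * f 1\<bar> \<le> 0"
    by (rule tendsto_lowerbound) (rule eventually_mono[OF eventually_gt_at_top[of 0] bound], simp_all)
  then show ?thesis by simp
qed

text \<open>
  The factor \<open>A\<close> is multiplicative because \<open>h\<close> is not constant. The increment \<open>k y = h (1 + y) - h 1\<close>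
  satisfies \<open>k (y + z) = k y + A y * k z\<close>; exchanging \<open>y\<close> and \<open>z\<close> shows that \<open>k y\<close> is proportional
  to \<open>1 - A y\<close>, unless \<open>A\<close> is identically \<open>1\<close>, and then \<open>k\<close> itself is additive. So the sign of \<open>k\<close> puts
  \<open>A\<close> on one side of \<open>1\<close>, the logarithm of \<open>A\<close> has constant sign, and Cauchy's equation makes \<open>A\<close> an
  exponential. The sign of the exponent separates the last two cases.
\<close>

lemma affine_shift_solutions:
  fixes h :: "real \<Rightarrow> real"
  assumes mono: "\<And>x z. 0 < x \<Longrightarrow> x \<le> z \<Longrightarrow> h x \<le> h z"
    and nonconst: "0 < p" "0 < q" "h p < h q"
    and shift: "\<And>y. y \<ge> 0 \<Longrightarrow> \<exists>A. \<forall>x>0. \<forall>z>0. h (x + y) - h (z + y) = A * (h x - h z)"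
  shows "(\<exists>\<theta>>0. \<exists>\<beta>. \<forall>x>0. h x = \<theta> * x + \<beta>) \<or>
         (\<exists>\<gamma>>0. \<exists>\<theta>>0. \<exists>\<beta>. \<forall>x>0. h x = \<theta> * exp (\<gamma> * x) + \<beta>) \<or>
         (\<exists>\<gamma>>0. \<exists>\<theta>>0. \<exists>\<beta>. \<forall>x>0. h x = - \<theta> * exp (- \<gamma> * x) + \<beta>)"
proof -
  from shift obtain A where A: "\<And>x y z. y \<ge> 0 \<Longrightarrow> x > 0 \<Longrightarrow> z > 0 \<Longrightarrow>
      h (x + y) - h (z + y) = A y * (h x - h z)"
    by metis
  have A_add: "A (y + z) = A y * A z" if "y \<ge> 0" "z \<ge> 0" for y z
  proof -
    have "A (y + z) * (h q - h p) = A y * A z * (h q - h p)"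
      using A[of "y + z" q p] A[of y "q + z" "p + z"] A[of z q p] that nonconst
      by (simp add: algebra_simps)
    then show ?thesis using nonconst by simp
  qed
  \<comment> \<open>A zero at \<open>y\<close> descends to \<open>y / 2 ^ k\<close>, and \<open>A w = 0\<close> makes \<open>h\<close> constant beyond \<open>w\<close>.\<close>
  have A_nz: "A y \<noteq> 0" if "y \<ge> 0" for y
  proof
    assume "A y = 0"
    have zero: "A (y / 2 ^ k) = 0" for k :: nat
    proof (induction k)
      case 0
      then show ?case using \<open>A y = 0\<close> by simp
    next
      case (Suc k)
      have "A (y / 2 ^ k) = A (y / 2 ^ Suc k) * A (y / 2 ^ Suc k)"
        using A_add[of "y / 2 ^ Suc k" "y / 2 ^ Suc k"] that by (simp add: field_simps)
      with Suc show ?case by simp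
    qed
    have "(\<lambda>k. y / 2 ^ k) \<longlonglongrightarrow> 0"
      by real_asymp
    from order_tendstoD(2)[OF this, of "min p q"] nonconst
    obtain k :: nat where k: "y / 2 ^ k < p" "y / 2 ^ k < q"
      by (auto simp: eventually_sequentially)
    have "h q = h p"
      using A[of "y / 2 ^ k" "q - y / 2 ^ k" "p - y / 2 ^ k"] zero[of k] k that by simp
    with nonconst show False by simp
  qed
  have A_pos: "A y > 0" if "y \<ge> 0" for y
    using A_add[of "y / 2" "y / 2"] A_nz[of "y / 2"] that by (simp flip: power2_eq_square)
  define k where "k = (\<lambda>y. h (1 + y) - h 1)"
  have k_nonneg: "k y \<ge> 0" if "y \<ge> 0" for y
    using mono[of 1 "1 + y"] that by (simp add: k_def)
  have k_add: "k (y + z) = k y + A y * k z" if "y \<ge> 0" "z \<ge> 0" for y z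
    using A[of y "1 + z" 1] that by (simp add: k_def algebra_simps)
  have k_swap: "k y * (1 - A z) = k z * (1 - A y)" if "y \<ge> 0" "z \<ge> 0" for y z
    using k_add[of y z] k_add[of z y] that by (simp add: algebra_simps)
  \<comment> \<open>Shifting by \<open>1\<close> recovers \<open>h\<close> on all of \<open>x > 0\<close> from the increments beyond \<open>1\<close>.\<close>
  have h_eq: "h x = h 1 + (k x - k 1) / A 1" if "x > 0" for x
    using A[of 1 x 1] A_pos[of 1] that by (simp add: k_def field_simps)
  have k1: "k 1 > 0"
  proof -
    have "k 1 \<noteq> 0"
    proof
      assume "k 1 = 0"
      have const: "h x = h 1" if "x > 0" for x
      proof -
        have kn: "k (real n) = 0" for n
        proof (induction n)
          case 0
          then show ?case by (simp add: k_def)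
        next
          case (Suc n)
          then show ?case using k_add[of 1 "real n"] \<open>k 1 = 0\<close> by simp
        qed
        obtain n where "x \<le> real n" using real_arch_simple by blast
        then have "k x \<le> k (real n)"
          using mono[of "1 + x" "1 + real n"] that by (simp add: k_def)
        then have "k x = 0"
          using kn[of n] k_nonneg[of x] that by simp
        then show ?thesis
          using h_eq[OF that] \<open>k 1 = 0\<close> by simp
      qed
      show False using const[of p] const[of q] nonconst by simp
    qed
    with k_nonneg[of 1] show ?thesis by simp
  qed
  show ?thesis
  proof (cases "A 1 = 1")
    case True
    have one: "A y = 1" if "y \<ge> 0" for y
      using k_swap[of 1 y] k1 True that by simp
    have kx: "k x = x * k 1" if "x \<ge> 0" for x
    proof (rule nonneg_additive_imp_linear[OF k_nonneg _ that])
      show "k (y + z) = k y + k z" if "y \<ge> 0" "z \<ge> 0" for y z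
        using k_add[OF that] one[OF that(1)] by simp
    qed
    have "h x = k 1 * x + (h 1 - k 1)" if "x > 0" for x
      using h_eq[OF that] kx[of x] True that by (simp add: algebra_simps)
    with k1 show ?thesis by blast
  next
    case False
    define c where "c = k 1 / (1 - A 1)"
    have c: "c \<noteq> 0" using k1 False by (simp add: c_def)
    have kc: "k y = c * (1 - A y)" if "y \<ge> 0" for y
      using k_swap[of y 1] False that by (simp add: c_def field_simps)
    have ln_add: "ln (A (y + z)) = ln (A y) + ln (A z)" if "y \<ge> 0" "z \<ge> 0" for y z
      using A_add[OF that] A_pos[OF that(1)] A_pos[OF that(2)] by (simp add: ln_mult)
    show ?thesis
    proof (cases "c < 0")
      case True
      have ge: "A y \<ge> 1" if "y \<ge> 0" for y
        using kc[OF that] k_nonneg[OF that] True by (simp add: zero_le_mult_iff)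
      have "ln (A y) = y * ln (A 1)" if "y \<ge> 0" for y
        by (rule nonneg_additive_imp_linear) (use ge ln_add that in auto)
      then have Ay: "A y = exp (ln (A 1) * y)" if "y \<ge> 0" for y
        using A_pos[OF that] that by (metis exp_ln mult.commute)
      have "ln (A 1) > 0"
        using ge[of 1] False by simp
      moreover have "- c / A 1 > 0"
        using True A_pos[of 1] by (simp add: divide_neg_pos)
      moreover have "h x = (- c / A 1) * exp (ln (A 1) * x) + (h 1 + c)" if "x > 0" for x
      proof -
        have "h x = h 1 + c * (A 1 - A x) / A 1"
          using h_eq[OF that] kc[of x] kc[of 1] that by (simp add: algebra_simps)
        also have "\<dots> = (- c / A 1) * A x + (h 1 + c)"
          using A_pos[of 1] by (simp add: field_simps)
        finally show ?thesis using Ay[of x] that by simp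
      qed
      ultimately show ?thesis by blast
    next
      case c_pos: False
      have le: "A y \<le> 1" if "y \<ge> 0" for y
        using kc[OF that] k_nonneg[OF that] c_pos c by (simp add: zero_le_mult_iff)
      have "- ln (A y) = y * (- ln (A 1))" if "y \<ge> 0" for y
        by (rule nonneg_additive_imp_linear) (use le A_pos ln_add that in auto)
      then have Ay: "A y = exp (- (- ln (A 1)) * y)" if "y \<ge> 0" for y
        using A_pos[OF that] that by (metis exp_ln minus_minus minus_mult_right mult.commute)
      have "- ln (A 1) > 0"
        using le[of 1] A_pos[of 1] False by simp
      moreover have "c / A 1 > 0"
        using c_pos c A_pos[of 1] by simp
      moreover have "h x = - (c / A 1) * exp (- (- ln (A 1)) * x) + (h 1 + c)" if "x > 0" for x
      proof -
        have "h x = h 1 + c * (A 1 - A x) / A 1"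
          using h_eq[OF that] kc[of x] kc[of 1] that by (simp add: algebra_simps)
        also have "\<dots> = - (c / A 1) * A x + (h 1 + c)"
          using A_pos[of 1] by (simp add: field_simps)
        finally show ?thesis using Ay[of x] that by simp
      qed
      ultimately show ?thesis by blast
    qed
  qed
qed

section \<open>Recovering the distribution function\<close>

lemma eq_if_same_exp_levels:
  fixes s t :: real
  assumes "0 \<le> s" "s \<le> 1" "0 \<le> t" "t \<le> 1"
    and same: "\<And>v. v > 0 \<Longrightarrow> 1 - exp (- v) \<le> s \<longleftrightarrow> 1 - exp (- v) \<le> t"
  shows "s = t"
proof -
  have le: "s \<le> t" if "0 \<le> s" "s \<le> 1" "0 \<le> t" "t \<le> 1"
     "\<And>v. v > 0 \<Longrightarrow> 1 - exp (- v) \<le> s \<Longrightarrow> 1 - exp (- v) \<le> t" for s t :: real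
  proof (rule dense_le)
    fix x assume "x < s"
    show "x \<le> t"
    proof (cases "x \<le> 0")
      case False
      have "1 - exp (- (- ln (1 - x))) = x"
        using \<open>x < s\<close> that(2) by simp
      moreover have "- ln (1 - x) > 0"
        using \<open>x < s\<close> that(2) False by simp
      ultimately show ?thesis
        using that(5)[of "- ln (1 - x)"] \<open>x < s\<close> by simp
    qed (use that in simp)
  qed
  show ?thesis
    by (rule antisym) (rule le; use assms in auto)+
qed

lemma free_extreme_value_bounds:
  assumes "free_extreme_value H"
  shows "0 \<le> H x \<and> H x \<le> 1"
proof -
  from assms consider "H = free_exponential" | \<alpha> where "\<alpha> > 0" "H = free_pareto \<alpha>"
    | \<alpha> where "\<alpha> > 0" "H = free_beta \<alpha>"
    unfolding free_extreme_value_def by blast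
  then show ?thesis
  proof cases
    case 1
    then show ?thesis by (simp add: free_exponential_def)
  next
    case 2
    then show ?thesis by (simp add: free_pareto_def)
  next
    case 3
    then show ?thesis by (simp add: free_beta_def powr_le1)
  qed
qed

text \<open>
  The next three lemmas compute the quantiles of the laws, in the form of the Galois connection
  that characterises them: \<open>v\<close>, \<open>exp (\<gamma> * v)\<close> and \<open>- exp (- \<gamma> * v)\<close>.
\<close>

lemma free_exponential_level:
  assumes "v > 0"
  shows "1 - exp (- v) \<le> free_exponential x \<longleftrightarrow> v \<le> x"
  using assms by (simp add: free_exponential_def le_max_iff_disj)

lemma free_pareto_level:
  assumes "v > 0" "\<gamma> > 0"
  shows "1 - exp (- v) \<le> free_pareto (1 / \<gamma>) x \<longleftrightarrow> exp (\<gamma> * v) \<le> x"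
proof (cases "x > 0")
  case True
  have "1 - exp (- v) \<le> free_pareto (1 / \<gamma>) x \<longleftrightarrow> exp (- (1 / \<gamma>) * ln x) \<le> exp (- v)"
    using True assms by (auto simp: free_pareto_def le_max_iff_disj powr_def)
  also have "\<dots> \<longleftrightarrow> \<gamma> * v \<le> ln x"
    using assms by (simp add: field_simps)
  also have "\<dots> \<longleftrightarrow> exp (\<gamma> * v) \<le> x"
    using True by (simp add: ln_ge_iff)
  finally show ?thesis .
next
  case False
  then show ?thesis
    using assms by (auto simp: free_pareto_def intro: less_le_trans[OF exp_gt_zero])
qed

lemma free_beta_level:
  assumes "v > 0" "\<gamma> > 0"
  shows "1 - exp (- v) \<le> free_beta (1 / \<gamma>) x \<longleftrightarrow> - exp (- \<gamma> * v) \<le> x"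
proof -
  consider "x < - 1" | "- 1 \<le> x" "x < 0" | "x \<ge> 0" by linarith
  then show ?thesis
  proof cases
    case 1
    have "exp (- \<gamma> * v) \<le> 1" using assms by simp
    with 1 have "x < - exp (- \<gamma> * v)" by linarith
    with 1 show ?thesis using assms by (simp add: free_beta_def)
  next
    case 2
    have "1 - exp (- v) \<le> free_beta (1 / \<gamma>) x \<longleftrightarrow> exp ((1 / \<gamma>) * ln (- x)) \<le> exp (- v)"
      using 2 assms by (auto simp: free_beta_def powr_def)
    also have "\<dots> \<longleftrightarrow> ln (- x) \<le> - \<gamma> * v"
      using assms by (simp add: field_simps)
    also have "\<dots> \<longleftrightarrow> - exp (- \<gamma> * v) \<le> x"
      using 2 by (metis exp_le_cancel_iff exp_ln minus_le_iff neg_0_less_iff_less)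
    finally show ?thesis .
  next
    case 3
    then show ?thesis using assms
      by (auto simp: free_beta_def intro: order_trans[of _ 0])
  qed
qed

lemma free_extreme_value_typeI:
  assumes G: "distribution_function G" and H: "free_extreme_value H" and "\<theta> > 0"
    and level: "\<And>v x. v > 0 \<Longrightarrow>
      log_quantile G v \<le> \<theta> * x + \<beta> \<longleftrightarrow> 1 - exp (- v) \<le> H x"
  shows "free_extreme_value_type G"
proof -
  have "G (\<theta> * x + \<beta>) = H x" for x
    by (rule eq_if_same_exp_levels)
       (use distribution_function_bounds[OF G] free_extreme_value_bounds[OF H]
          level log_quantile_le_iff[OF G] in auto)
  then have "(\<lambda>x. G (\<theta> * x + \<beta>)) = H" by blast
  with assms show ?thesis
    unfolding free_extreme_value_type_def by metis
qed

section \<open>Stability of the three types\<close>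

text \<open>
  Off the half-line where the Pareto law is \<open>0\<close> and the one where the Beta law is \<open>1\<close>, each law has
  the form \<open>max (1 - c) 0\<close> with a tail \<open>c\<close> that a translation or a dilation divides by
  \<open>n\<close>. Iterating \<open>n\<close> times multiplies the tail by \<open>n\<close> again, and truncating before
  the iteration changes nothing.
\<close>

lemma truncated_tail_div:
  fixes n c :: real
  assumes "n \<ge> 1"
  shows "max (n * max (1 - c / n) 0 - (n - 1)) 0 = max (1 - c) 0"
proof (cases "c \<le> n")
  case True
  then have "max (1 - c / n) 0 = 1 - c / n"
    using assms by simp
  moreover have "n * (1 - c / n) - (n - 1) = 1 - c"
    using assms by (simp add: field_simps)
  ultimately show ?thesis
    by simp
next
  case False
  then have "max (1 - c / n) 0 = 0"
    using assms by simp
  then show ?thesis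
    using assms False by simp
qed

lemma free_extreme_value_stable:
  assumes H: "free_extreme_value H" and n: "n \<ge> (1::nat)"
  shows "\<exists>\<alpha>>0. \<exists>\<beta>. \<forall>x. max (real n * H (\<alpha> * x + \<beta>) - (real n - 1)) 0 = H x"
proof -
  have n': "real n \<ge> 1" using n by simp
  from H consider "H = free_exponential" | \<gamma> where "\<gamma> > 0" "H = free_pareto \<gamma>"
    | \<gamma> where "\<gamma> > 0" "H = free_beta \<gamma>"
    unfolding free_extreme_value_def by blast
  then show ?thesis
  proof cases
    case 1
    have "max (real n * H (1 * x + ln n) - (real n - 1)) 0 = H x" for x
    proof -
      have e: "exp (- (x + ln n)) = exp (- x) / n"
        using n by (simp add: exp_diff exp_minus field_simps exp_add)
      then show ?thesis
        using truncated_tail_div[OF n'] unfolding 1 free_exponential_def mult_1 by simp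
    qed
    then show ?thesis by (intro exI[of _ 1]) auto
  next
    case 2
    define \<alpha> where "\<alpha> = real n powr (1 / \<gamma>)"
    have \<alpha>: "\<alpha> > 0" using n by (simp add: \<alpha>_def)
    have "max (real n * H (\<alpha> * x + 0) - (real n - 1)) 0 = H x" for x
    proof (cases "x > 0")
      case True
      have "(\<alpha> * x) powr (- \<gamma>) = x powr (- \<gamma>) / n"
        using True n 2 by (simp add: \<alpha>_def powr_mult powr_powr powr_minus field_simps)
      then show ?thesis
        using truncated_tail_div[OF n'] mult_pos_pos[OF \<alpha> True] True
        unfolding 2 free_pareto_def by simp
    next
      case False
      then show ?thesis
        using n' \<alpha> unfolding 2 free_pareto_def by (auto simp: max_def zero_less_mult_iff)
    qed
    with \<alpha> show ?thesis by blast
  next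
    case 3
    define \<alpha> where "\<alpha> = real n powr (- 1 / \<gamma>)"
    have \<alpha>: "\<alpha> > 0" using n by (simp add: \<alpha>_def)
    have "max (real n * H (\<alpha> * x + 0) - (real n - 1)) 0 = H x" for x
    proof (cases "x > 0")
      case True
      have one: "H z = 1" if "z > 0" for z
        using that by (simp add: 3 free_beta_def)
      show ?thesis
        using one[OF True] one[OF mult_pos_pos[OF \<alpha> True]] by simp
    next
      case False
      have eq: "\<bar>\<alpha> * x\<bar> powr \<gamma> = \<bar>x\<bar> powr \<gamma> / n"
        using \<alpha> n 3 by (simp add: \<alpha>_def abs_mult powr_mult powr_divide powr_powr powr_minus field_simps)
      have "\<alpha> * x \<le> 0" using \<alpha> False by (simp add: mult_le_0_iff)
      have trunc: "free_beta \<gamma> z = max (1 - \<bar>z\<bar> powr \<gamma>) 0" if "z \<le> 0" for z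
      proof (cases "z < - 1")
        case True
        then have "1 \<le> \<bar>z\<bar> powr \<gamma>" using 3(1) by (simp add: ge_one_powr_ge_zero)
        with True show ?thesis by (simp add: free_beta_def)
      next
        case False
        then have "\<bar>z\<bar> powr \<gamma> \<le> 1" using 3(1) that by (simp add: powr_le1)
        with False that show ?thesis by (simp add: free_beta_def)
      qed
      show ?thesis
        using truncated_tail_div[OF n'] False \<open>\<alpha> * x \<le> 0\<close>
        unfolding 3 by (simp only: trunc eq not_less add_0_right)
    qed
    with \<alpha> show ?thesis by blast
  qed
qed

theorem theorem6p10:
  fixes G :: "real \<Rightarrow> real"
  assumes "distribution_function G"
    and "\<not> degenerate G"
  shows "(\<exists>F (a :: nat \<Rightarrow> real) (b :: nat \<Rightarrow> real).
            distribution_function F \<and> (\<forall>n\<ge>1. a n > 0) \<and>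
            (\<forall>x. isCont G x \<longrightarrow>
               (\<lambda>n. free_max_pow n F (a n * x + b n)) \<longlonglongrightarrow> G x))
         \<longleftrightarrow> free_extreme_value_type G"
proof
  assume "\<exists>F (a :: nat \<Rightarrow> real) (b :: nat \<Rightarrow> real).
            distribution_function F \<and> (\<forall>n\<ge>1. a n > 0) \<and>
            (\<forall>x. isCont G x \<longrightarrow>
               (\<lambda>n. free_max_pow n F (a n * x + b n)) \<longlonglongrightarrow> G x)"
  then obtain F a b where F: "distribution_function F"
    and a: "\<And>n. n \<ge> 1 \<Longrightarrow> a n > 0"
    and lim: "\<And>x. isCont G x \<Longrightarrow> (\<lambda>n. free_max_pow n F (a n * x + b n)) \<longlonglongrightarrow> G x"
    by blast
  obtain p q where "0 < p" "0 < q" "log_quantile G p < log_quantile G q"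
    using exists_log_quantile_less[OF assms] by blast
  from affine_shift_solutions[OF log_quantile_mono[OF assms(1)] this
      log_quantile_shift[OF F assms a lim]]
  consider
      \<theta> \<beta> where "\<theta> > 0" "\<And>v. v > 0 \<Longrightarrow> log_quantile G v = \<theta> * v + \<beta>"
    | \<gamma> \<theta> \<beta> where "\<gamma> > 0" "\<theta> > 0"
        "\<And>v. v > 0 \<Longrightarrow> log_quantile G v = \<theta> * exp (\<gamma> * v) + \<beta>"
    | \<gamma> \<theta> \<beta> where "\<gamma> > 0" "\<theta> > 0"
        "\<And>v. v > 0 \<Longrightarrow> log_quantile G v = - \<theta> * exp (- \<gamma> * v) + \<beta>"
    by blast
  then show "free_extreme_value_type G"
  proof cases
    case 1
    have "free_extreme_value free_exponential"
      by (simp add: free_extreme_value_def)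
    from free_extreme_value_typeI[OF assms(1) this 1(1), of \<beta>] show ?thesis
      using 1 by (simp add: free_exponential_level)
  next
    case 2
    have "free_extreme_value (free_pareto (1 / \<gamma>))"
      unfolding free_extreme_value_def using 2(1) divide_pos_pos[OF zero_less_one] by blast
    from free_extreme_value_typeI[OF assms(1) this 2(2), of \<beta>] show ?thesis
      using 2 by (simp add: free_pareto_level)
  next
    case 3
    have "free_extreme_value (free_beta (1 / \<gamma>))"
      unfolding free_extreme_value_def using 3(1) divide_pos_pos[OF zero_less_one] by blast
    moreover have "log_quantile G v \<le> \<theta> * x + \<beta> \<longleftrightarrow> 1 - exp (- v) \<le> free_beta (1 / \<gamma>) x"
      if "v > 0" for v x
    proof -
      have "log_quantile G v \<le> \<theta> * x + \<beta> \<longleftrightarrow> \<theta> * (- exp (- \<gamma> * v)) \<le> \<theta> * x"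
        using 3(3)[OF that] by simp
      also have "\<dots> \<longleftrightarrow> - exp (- \<gamma> * v) \<le> x"
        using 3(2) by (rule mult_le_cancel_left_pos)
      finally show ?thesis
        using free_beta_level[OF that 3(1)] by simp
    qed
    ultimately show ?thesis
      by (rule free_extreme_value_typeI[OF assms(1) _ 3(2)])
  qed
next
  assume "free_extreme_value_type G"
  then obtain a b where a: "a > 0" and H: "free_extreme_value (\<lambda>x. G (a * x + b))"
    unfolding free_extreme_value_type_def by blast
  define H where "H = (\<lambda>x. G (a * x + b))"
  have GH: "G z = H ((z - b) / a)" for z
    using a by (simp add: H_def)
  have "\<forall>n. \<exists>\<alpha>. \<exists>\<beta>. n \<ge> 1 \<longrightarrow> \<alpha> > 0 \<and>
      (\<forall>x. max (real n * H (\<alpha> * x + \<beta>) - (real n - 1)) 0 = H x)"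
    using free_extreme_value_stable[OF H] unfolding H_def by blast
  from choice[OF this] obtain \<alpha> where
    "\<forall>n. \<exists>\<beta>. n \<ge> 1 \<longrightarrow> \<alpha> n > 0 \<and>
      (\<forall>x. max (real n * H (\<alpha> n * x + \<beta>) - (real n - 1)) 0 = H x)" ..
  from choice[OF this] obtain \<beta> where \<alpha>: "\<And>n::nat. n \<ge> 1 \<Longrightarrow> \<alpha> n > 0"
    and stable: "\<And>n x. n \<ge> 1 \<Longrightarrow> max (real n * H (\<alpha> n * x + \<beta> n) - (real n - 1)) 0 = H x"
    by blast
  \<comment> \<open>The rescaling of \<open>H\<close>, conjugated by the affine map that takes \<open>H\<close> to \<open>G\<close>.\<close>
  define d where "d = (\<lambda>n. b + a * \<beta> n - \<alpha> n * b)"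
  have "free_max_pow n G (\<alpha> n * x + d n) = G x" if "n \<ge> 1" for n x
  proof -
    have "(\<alpha> n * x + d n - b) / a = \<alpha> n * ((x - b) / a) + \<beta> n"
      using a by (simp add: d_def field_simps)
    then show ?thesis
      using stable[OF that, of "(x - b) / a"] by (simp add: free_max_pow_eq[OF assms(1)] GH)
  qed
  then have "(\<lambda>n. free_max_pow n G (\<alpha> n * x + d n)) \<longlonglongrightarrow> G x" for x
    by (intro tendsto_eventually) (auto simp: eventually_sequentially)
  with \<alpha> assms(1) show "\<exists>F (a :: nat \<Rightarrow> real) (b :: nat \<Rightarrow> real).
            distribution_function F \<and> (\<forall>n\<ge>1. a n > 0) \<and>
            (\<forall>x. isCont G x \<longrightarrow>
               (\<lambda>n. free_max_pow n F (a n * x + b n)) \<longlonglongrightarrow> G x)"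
    by blast
qed

end
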